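(* Let $c_1,\dots,c_N$ be effort cost functions satisfying the standing assumptions in the context. Suppose that the condition $$-2\,c_i'(\xi_i)-c_i''(\xi_i)\,(\xi_x+\xi_i)<0\quad\text{for all } i\in\{1,\dots,N\}\text{ and all }\xi_i\in[0,\xi_{iu}]$$ does not hold. Let $\tilde\phi=(\tilde\phi_1,\dots,\tilde\phi_N)$ be an optimal solution of $$\min_{\phi}\ \sum_{i=1}^N\phi_i\,c_i(\xi_{iu})\quad\text{s.t.}\quad \frac{1}{\xi_x+\sum_{i=1}^N\phi_i\xi_{iu}}\le\Sigma_t,\qquad \phi_i\in\{0,1\}\ \ (i=1,\dots,N),$$ and assume that at least two sensors have $\tilde\phi_i=1$. For each $i$ with $\tilde\phi_i=1$ let $j=j(i)\ne i$ be another sensor with $\tilde\phi_j=1$, and let the payments be $$p_i(\hat x_{ri},y_{rj})=\begin{cases}\gamma_i-\beta_i(\hat x_{ri}-y_{rj})^2, & \tilde\phi_i=1,\\ 0,&\tilde\phi_i=0,\end{cases}$$ where $$\beta_i>\max_{\xi_i\in[0,\xi_{iu}]}c_i'(\xi_i)(\xi_x+\xi_i)^2,\qquad \gamma_i=\beta_i\left(\frac{1}{\xi_x+\xi_{iu}}+\xi_{ju}^{-1}\right)+c_i(\xi_{iu}).$$ Then the strategy profile $s^*=(s_1^*,\dots,s_N^* )$ with $$s_i^*=\begin{cases}(\xi_i=\xi_{iu},\ \hat x_{ri}=\hat x_i,\ y_{ri}=y_i),&\tilde\phi_i=1,\\ (\xi_i=0,\ \hat x_{ri}=\hat x_i,\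 y_{ri}=y_i),&\tilde\phi_i=0,\end{cases}$$ is a Nash equilibrium of the game among the sensors. In addition, under $s^*$ the expected payment to each selected sensor (each $i$ with $\tilde\phi_i=1$) equals its effort cost at its maximum effort level: $\mathbb E[p_i]=c_i(\xi_{iu})$.
   Context: Estimation model. $X\sim\mathcal N(0,\sigma_x^2)$ is a scalar random variable, with $\sigma_x^2>0$ and $\xi_x=\sigma_x^{-2}$. There are $N$ sensors (agents). Sensor $i$ chooses an effort level $\xi_i\in[0,\xi_{iu}]$, where $\xi_{iu}>0$ is its maximum effort level, and observes $y_i=X+v_i$ with $v_i\sim\mathcal N(0,\sigma_i^2)$, $\sigma_i^2=\xi_i^{-1}$. The noises $v_1,\dots,v_N$ are mutually independent and independent of $X$. The local (MMSE) estimate of sensor $i$ is $$\hat x_i=\frac{\sigma_x^2}{\sigma_x^2+\sigma_i^2}\,y_i=\mathbb E[X\mid y_i].$$ Convention: $\xi_i=0$ means $\sigma_i^2=\infty$, i.e. the sensor has no informative observation; then $\hat x_i=0$, its report $\hat x_{ri}$ is a constant, and its measurement report is an arbitrary fixed number. Effort costs. Exerting effort $\xi_i$ costs $c_i(\xi_i)$, where $c_i:[0,\xi_{iu}]\to[0,\infty)$ is twice differentiable and bounded, $c_i(0)=0$, and $c_i'(\xi_i)>0$ for all $\xi_i\in[0,\xi_{iu}]$. Threshold. $\Sigma_t>0$ is a prescribed upper bound on the estimator's global mean squared error. Game. A strategy of sensor $i$ is a triple $s_i=(\xi_i,\hat x_{ri},y_{ri})$: the effort level $\xi_i\in[0,\xi_{iu}]$,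 the reported local estimate $\hat x_{ri}$ and the reported measurement $y_{ri}$. The two reports are real-valued measurable functions of the sensor's own observation $y_i$ (they may depend on the chosen $\xi_i$) and need not equal $\hat x_i$ and $y_i$. The estimator sees only the reports. The estimator fixes the payment functions $p_i$ in advance. The expected utility of sensor $i$ is $\mathbb E[U_i]=\mathbb E[p_i-c_i(\xi_i)]$, with the expectation over $X$ and all measurement noises (the value $-\infty$ is allowed). A profile $s^*$ is a Nash equilibrium if for every $i$ the strategy $s_i^*$ maximizes $\mathbb E[U_i]$ over all strategies $s_i$ of sensor $i$ when all other sensors $k\neq i$ use $s_k^*$. *)

theory Defs
  imports "HOL-Probability.Probability"
begin

text \<open>
  Sensors are indexed by \<open>{1..N}\<close>. \<open>X\<close> is the state, with standard deviation \<open>\<sigma>x\<close>; \<open>u i\<close> is the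
  maximum effort of sensor \<open>i\<close>; \<open>v i e\<close> is the noise of sensor \<open>i\<close> when it exerts effort \<open>e\<close>.
  The second parameter of \<open>normal_density\<close> is a standard deviation, so effort \<open>e > 0\<close> gives noise
  variance \<open>1 / e\<close>. Independence is required for every admissible effort profile \<open>\<xi>\<close>, between \<open>X\<close>
  (index \<open>None\<close>) and the noises of the sensors that exert positive effort; a sensor with zero
  effort has infinite noise variance, and \<open>v i 0\<close> is never used.
\<close>

definition sensor_model ::
  "'a measure \<Rightarrow> nat \<Rightarrow> real \<Rightarrow> (nat \<Rightarrow> real) \<Rightarrow> ('a \<Rightarrow> real) \<Rightarrow> (nat \<Rightarrow> real \<Rightarrow> 'a \<Rightarrow> real) \<Rightarrow> bool"
where
  "sensor_model M N \<sigma>x u X v \<longleftrightarrow>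
     prob_space M \<and>
     0 < \<sigma>x \<and>
     (\<forall>i\<in>{1..N}. 0 < u i) \<and>
     distributed M lborel X (normal_density 0 \<sigma>x) \<and>
     (\<forall>i\<in>{1..N}. \<forall>e\<in>{0<..u i}. distributed M lborel (v i e) (normal_density 0 (sqrt (1 / e)))) \<and>
     (\<forall>\<xi>. (\<forall>i\<in>{1..N}. \<xi> i \<in> {0..u i}) \<longrightarrow>
        prob_space.indep_vars M (\<lambda>_. borel)
          (\<lambda>k. case k of None \<Rightarrow> X | Some i \<Rightarrow> v i (\<xi> i))
          (insert None (Some ` {i\<in>{1..N}. 0 < \<xi> i})))"

text \<open>
  With zero effort the observation is an arbitrary fixed number \<open>y0 i\<close>, so that every report of
  the sensor is a constant.
\<close>

definition observation ::
  "('a \<Rightarrow> real) \<Rightarrow> (nat \<Rightarrow> real \<Rightarrow> 'a \<Rightarrow> real) \<Rightarrow> (nat \<Rightarrow> real) \<Rightarrow> nat \<Rightarrow> real \<Rightarrow> 'a \<Rightarrow> real"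
where
  "observation X v y0 i e \<omega> = (if e = 0 then y0 i else X \<omega> + v i e \<omega>)"

definition local_estimate :: "real \<Rightarrow> real \<Rightarrow> real \<Rightarrow> real" where
  "local_estimate \<sigma>x e y = (if e = 0 then 0 else \<sigma>x\<^sup>2 / (\<sigma>x\<^sup>2 + 1 / e) * y)"

text \<open>
  \<open>c'\<close> and \<open>c''\<close> are the first and second derivative of the cost \<open>c\<close> on \<open>[0, ub]\<close>, one-sided at
  the endpoints; for \<open>ub > 0\<close> they are uniquely determined there.
\<close>

definition effort_cost ::
  "real \<Rightarrow> (real \<Rightarrow> real) \<Rightarrow> (real \<Rightarrow> real) \<Rightarrow> (real \<Rightarrow> real) \<Rightarrow> bool"
where
  "effort_cost ub c c' c'' \<longleftrightarrow>
     (\<forall>x\<in>{0..ub}. 0 \<le> c x) \<and>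
     bounded (c ` {0..ub}) \<and>
     c 0 = 0 \<and>
     (\<forall>x\<in>{0..ub}. (c has_real_derivative c' x) (at x within {0..ub})) \<and>
     (\<forall>x\<in>{0..ub}. (c' has_real_derivative c'' x) (at x within {0..ub})) \<and>
     (\<forall>x\<in>{0..ub}. 0 < c' x)"

text \<open>The reports are functions of the sensor's own observation.\<close>

record strategy =
  effort :: real
  est_report :: "real \<Rightarrow> real"
  meas_report :: "real \<Rightarrow> real"

definition strategies :: "real \<Rightarrow> strategy set" where
  "strategies ub = {s. effort s \<in> {0..ub} \<and>
     est_report s \<in> borel_measurable borel \<and> meas_report s \<in> borel_measurable borel}"

text \<open>
  A payment rule maps a sensor, the vector of reported estimates and the vector of reported
  measurements to the payment of that sensor.
\<close>

type_synonym payment_rule = "nat \<Rightarrow> (nat \<Rightarrow> real) \<Rightarrow> (nat \<Rightarrow> real) \<Rightarrow> real"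

definition realized_payment ::
  "('a \<Rightarrow> real) \<Rightarrow> (nat \<Rightarrow> real \<Rightarrow> 'a \<Rightarrow> real) \<Rightarrow> (nat \<Rightarrow> real) \<Rightarrow> payment_rule \<Rightarrow>
   nat \<Rightarrow> (nat \<Rightarrow> strategy) \<Rightarrow> 'a \<Rightarrow> real"
where
  "realized_payment X v y0 p i s \<omega> =
     p i (\<lambda>k. est_report (s k) (observation X v y0 k (effort (s k)) \<omega>))
         (\<lambda>k. meas_report (s k) (observation X v y0 k (effort (s k)) \<omega>))"

text \<open>
  Expectation with values in the extended reals. It agrees with the Lebesgue integral for
  integrable functions and is \<open>-\<infinity>\<close> if only the negative part has infinite integral. (For
  \<open>\<infinity> - \<infinity>\<close>, Isabelle's convention gives \<open>\<infinity>\<close>; this cannot occur for random variables bounded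
  above.)
\<close>

definition ext_expectation :: "'a measure \<Rightarrow> ('a \<Rightarrow> real) \<Rightarrow> ereal" where
  "ext_expectation M f =
     enn2ereal (\<integral>\<^sup>+\<omega>. ennreal (f \<omega>) \<partial>M) - enn2ereal (\<integral>\<^sup>+\<omega>. ennreal (- f \<omega>) \<partial>M)"

definition expected_payment ::
  "'a measure \<Rightarrow> ('a \<Rightarrow> real) \<Rightarrow> (nat \<Rightarrow> real \<Rightarrow> 'a \<Rightarrow> real) \<Rightarrow> (nat \<Rightarrow> real) \<Rightarrow> payment_rule \<Rightarrow>
   nat \<Rightarrow> (nat \<Rightarrow> strategy) \<Rightarrow> ereal"
where
  "expected_payment M X v y0 p i s = ext_expectation M (realized_payment X v y0 p i s)"

definition expected_utility ::
  "'a measure \<Rightarrow> ('a \<Rightarrow> real) \<Rightarrow> (nat \<Rightarrow> real \<Rightarrow> 'a \<Rightarrow> real) \<Rightarrow> (nat \<Rightarrow> real) \<Rightarrow>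
   (nat \<Rightarrow> real \<Rightarrow> real) \<Rightarrow> payment_rule \<Rightarrow> nat \<Rightarrow> (nat \<Rightarrow> strategy) \<Rightarrow> ereal"
where
  "expected_utility M X v y0 c p i s =
     ext_expectation M (\<lambda>\<omega>. realized_payment X v y0 p i s \<omega> - c i (effort (s i)))"

definition nash_equilibrium ::
  "'i set \<Rightarrow> ('i \<Rightarrow> 's set) \<Rightarrow> ('i \<Rightarrow> ('i \<Rightarrow> 's) \<Rightarrow> ereal) \<Rightarrow> ('i \<Rightarrow> 's) \<Rightarrow> bool"
where
  "nash_equilibrium I S U s \<longleftrightarrow>
     (\<forall>i\<in>I. s i \<in> S i \<and> (\<forall>t\<in>S i. U i (s(i := t)) \<le> U i s))"

definition feasible_selection ::
  "nat \<Rightarrow> real \<Rightarrow> (nat \<Rightarrow> real) \<Rightarrow> real \<Rightarrow> (nat \<Rightarrow> real) \<Rightarrow> bool"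
where
  "feasible_selection N \<xi>x u \<Sigma>t \<phi> \<longleftrightarrow>
     1 / (\<xi>x + (\<Sum>i\<in>{1..N}. \<phi> i * u i)) \<le> \<Sigma>t \<and> (\<forall>i\<in>{1..N}. \<phi> i \<in> {0, 1})"

definition optimal_selection ::
  "nat \<Rightarrow> real \<Rightarrow> (nat \<Rightarrow> real) \<Rightarrow> real \<Rightarrow> (nat \<Rightarrow> real \<Rightarrow> real) \<Rightarrow> (nat \<Rightarrow> real) \<Rightarrow> bool"
where
  "optimal_selection N \<xi>x u \<Sigma>t c \<phi> \<longleftrightarrow>
     feasible_selection N \<xi>x u \<Sigma>t \<phi> \<and>
     (\<forall>\<psi>. feasible_selection N \<xi>x u \<Sigma>t \<psi> \<longrightarrow>
        (\<Sum>i\<in>{1..N}. \<phi> i * c i (u i)) \<le> (\<Sum>i\<in>{1..N}. \<psi> i * c i (u i)))"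

definition peer_payment ::
  "(nat \<Rightarrow> real) \<Rightarrow> (nat \<Rightarrow> real) \<Rightarrow> (nat \<Rightarrow> real) \<Rightarrow> (nat \<Rightarrow> nat) \<Rightarrow> payment_rule"
where
  "peer_payment \<phi> \<beta> \<gamma> j i xr yr =
     (if \<phi> i = 1 then \<gamma> i - \<beta> i * (xr i - yr (j i))\<^sup>2 else 0)"

definition truthful_profile ::
  "real \<Rightarrow> (nat \<Rightarrow> real) \<Rightarrow> (nat \<Rightarrow> real) \<Rightarrow> nat \<Rightarrow> strategy"
where
  "truthful_profile \<sigma>x u \<phi> i =
     (let e = (if \<phi> i = 1 then u i else 0)
      in \<lparr>effort = e, est_report = local_estimate \<sigma>x e, meas_report = (\<lambda>y. y)\<rparr>)"

end

theory Submission
  imports Defs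
begin

text \<open>
  Given the report of sensor \<open>i\<close> and the truthful measurement \<open>X + v\<^sub>j\<close> of its peer, the expected
  squared discrepancy is the estimation error of the report plus \<open>1 / u\<^sub>j\<close>, because \<open>v\<^sub>j\<close> is
  independent of everything sensor \<open>i\<close> sees. With effort \<open>e\<close> the estimation error is at least
  \<open>1 / (\<xi>\<^sub>x + e)\<close>, with equality for the conditional mean. So the best utility attainable with
  effort \<open>e\<close> is at most \<open>\<gamma> - \<beta> (1 / (\<xi>\<^sub>x + e) + 1 / u\<^sub>j) - c e\<close>, whose derivative
  \<open>\<beta> / (\<xi>\<^sub>x + e)\<^sup>2 - c' e\<close> is positive by the choice of \<open>\<beta>\<close>: maximal effort is optimal, and
  \<open>\<gamma>\<close> makes the utility there zero. An unselected sensor is paid nothing, so it exerts no effort.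
\<close>

section \<open>Gaussian second moments and the posterior density\<close>

text \<open>Expand the square around the mean: the cross term carries the first central moment,
  which is zero, and the second central moment is the variance.\<close>

lemma nn_integral_normal_sq_dist:
  assumes "0 < \<sigma>"
  shows "(\<integral>\<^sup>+x. ennreal (normal_density \<mu> \<sigma> x) * ennreal ((a - x)\<^sup>2) \<partial>lborel)
    = ennreal ((a - \<mu>)\<^sup>2 + \<sigma>\<^sup>2)"
proof -
  let ?d = "normal_density \<mu> \<sigma>"
  have m0: "has_bochner_integral lborel ?d 1"
    using assms by (simp add: has_bochner_integral_iff)
  have m1: "has_bochner_integral lborel (\<lambda>x. ?d x * (x - \<mu>)) 0"
    using normal_moment_odd[OF assms, of \<mu> 0] by simp
  have m2: "has_bochner_integral lborel (\<lambda>x. ?d x * (x - \<mu>)\<^sup>2) (\<sigma>\<^sup>2)"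
    using normal_moment_even[OF assms, of \<mu> 1] by (simp add: fact_numeral)
  have "has_bochner_integral lborel
      (\<lambda>x. ?d x * (a - \<mu>)\<^sup>2 + (?d x * (x - \<mu>) * (- 2 * (a - \<mu>)) + ?d x * (x - \<mu>)\<^sup>2))
      (1 * (a - \<mu>)\<^sup>2 + (0 * (- 2 * (a - \<mu>)) + \<sigma>\<^sup>2))"
    by (intro has_bochner_integral_add has_bochner_integral_mult_left m0 m1 m2)
  also have "(\<lambda>x. ?d x * (a - \<mu>)\<^sup>2 + (?d x * (x - \<mu>) * (- 2 * (a - \<mu>)) + ?d x * (x - \<mu>)\<^sup>2))
      = (\<lambda>x. ?d x * (a - x)\<^sup>2)"
    by (rule ext) (simp add: power2_eq_square algebra_simps)
  finally have "has_bochner_integral lborel (\<lambda>x. ?d x * (a - x)\<^sup>2) ((a - \<mu>)\<^sup>2 + \<sigma>\<^sup>2)"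
    by simp
  then have "(\<integral>\<^sup>+x. ennreal (?d x * (a - x)\<^sup>2) \<partial>lborel) = ennreal ((a - \<mu>)\<^sup>2 + \<sigma>\<^sup>2)"
    by (simp add: has_bochner_integral_iff nn_integral_eq_integral)
  then show ?thesis
    by (simp add: ennreal_mult)
qed

text \<open>The density of \<open>X\<close> times that of \<open>Y\<close> given \<open>X\<close> equals the density of \<open>Y\<close> times that of
  \<open>X\<close> given \<open>Y\<close>, for \<open>Y = X + V\<close>.\<close>

lemma normal_density_bayes:
  assumes "0 < \<sigma>" "0 < \<tau>"
  shows "normal_density 0 \<sigma> x * normal_density 0 \<tau> (y - x)
    = normal_density 0 (sqrt (\<sigma>\<^sup>2 + \<tau>\<^sup>2)) y *
      normal_density (\<sigma>\<^sup>2 / (\<sigma>\<^sup>2 + \<tau>\<^sup>2) * y) (sqrt (\<sigma>\<^sup>2 * \<tau>\<^sup>2 / (\<sigma>\<^sup>2 + \<tau>\<^sup>2))) x"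
proof -
  define s t where "s = \<sigma>\<^sup>2" and "t = \<tau>\<^sup>2"
  have [simp]: "0 < s" "0 < t" "0 < s + t" and nz: "s \<noteq> 0" "t \<noteq> 0" "s + t \<noteq> 0"
    using assms by (auto simp: s_def t_def add_pos_pos)
  \<comment> \<open>Completing the square in \<open>x\<close>. With variances \<open>s\<close> and
    \<open>t\<close>, the posterior has variance \<open>s * t / (s + t)\<close> and mean
    \<open>s / (s + t) * y\<close>.\<close>
  have e: "- x\<^sup>2 / (2 * s) + - (y - x)\<^sup>2 / (2 * t)
    = - y\<^sup>2 / (2 * (s + t)) + - (x - s / (s + t) * y)\<^sup>2 / (2 * (s * t / (s + t)))"
    using nz by (simp add: divide_simps) (simp add: power2_eq_square algebra_simps)
  \<comment> \<open>The normalising constants agree because the marginal variance times the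
    posterior variance is again \<open>s * t\<close>.\<close>
  have r: "sqrt (2 * pi * s) * sqrt (2 * pi * t)
      = sqrt (2 * pi * (s + t)) * sqrt (2 * pi * (s * t / (s + t)))"
    unfolding real_sqrt_mult[symmetric] using nz by (intro arg_cong[where f=sqrt]) (simp add: field_simps)
  have sq: "(sqrt (s + t))\<^sup>2 = s + t" "(sqrt (s * t / (s + t)))\<^sup>2 = s * t / (s + t)"
    by (simp_all add: less_imp_le)
  have "normal_density 0 \<sigma> x * normal_density 0 \<tau> (y - x)
      = 1 / (sqrt (2 * pi * s) * sqrt (2 * pi * t)) * exp (- x\<^sup>2 / (2 * s) + - (y - x)\<^sup>2 / (2 * t))"
    unfolding normal_density_def s_def[symmetric] t_def[symmetric] exp_add by simp
  also have "\<dots> = normal_density 0 (sqrt (s + t)) y *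
      normal_density (s / (s + t) * y) (sqrt (s * t / (s + t))) x"
    unfolding e r exp_add normal_density_def sq by simp
  finally show ?thesis by (simp add: s_def t_def)
qed

section \<open>Mean squared errors under independent Gaussian noise\<close>

text \<open>The joint law is a product, so \<open>B\<close> can be integrated out first with
  \<open>A\<close> held fixed. Only \<open>B\<close> is given a density: later \<open>A\<close>
  involves an arbitrary measurable report, whose law may have none.\<close>

lemma (in prob_space) nn_integral_indep_distributed:
  fixes A B :: "'a \<Rightarrow> real" and f :: "real \<Rightarrow> real \<Rightarrow> ennreal"
  assumes ind: "indep_var borel A borel B" and B: "distributed M lborel B g"
    and f [measurable]: "case_prod f \<in> borel_measurable (borel \<Otimes>\<^sub>M borel)"
  shows "(\<integral>\<^sup>+\<omega>. f (A \<omega>) (B \<omega>) \<partial>M) = (\<integral>\<^sup>+\<omega>. (\<integral>\<^sup>+b. g b * f (A \<omega>) b \<partial>lborel) \<partial>M)"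
proof -
  have [measurable]: "random_variable borel A" "random_variable borel B"
    using ind indep_var_rv1 indep_var_rv2 by blast+
  have [measurable]: "g \<in> borel_measurable borel"
    using distributed_borel_measurable[OF B] by simp
  interpret B: prob_space "distr M borel B" by (rule prob_space_distr) simp
  have f': "case_prod f \<in> borel_measurable (borel \<Otimes>\<^sub>M distr M borel B)"
    by simp
  have f'': "case_prod f \<in> borel_measurable (distr M borel A \<Otimes>\<^sub>M distr M borel B)"
    by simp
  have "(\<integral>\<^sup>+\<omega>. f (A \<omega>) (B \<omega>) \<partial>M)
      = (\<integral>\<^sup>+z. case_prod f z \<partial>distr M (borel \<Otimes>\<^sub>M borel) (\<lambda>\<omega>. (A \<omega>, B \<omega>)))"
    by (subst nn_integral_distr) simp_all
  also have "\<dots> = (\<integral>\<^sup>+z. case_prod f z \<partial>(distr M borel A \<Otimes>\<^sub>M distr M borel B))"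
    using ind by (simp add: indep_var_distribution_eq)
  also have "\<dots> = (\<integral>\<^sup>+a. \<integral>\<^sup>+b. f a b \<partial>distr M borel B \<partial>distr M borel A)"
    using B.nn_integral_fst[OF f''] by simp
  also have "\<dots> = (\<integral>\<^sup>+\<omega>. \<integral>\<^sup>+b. f (A \<omega>) b \<partial>distr M borel B \<partial>M)"
    using B.borel_measurable_nn_integral_fst[OF f'] by (subst nn_integral_distr) simp_all
  also have "\<dots> = (\<integral>\<^sup>+\<omega>. (\<integral>\<^sup>+b. g b * f (A \<omega>) b \<partial>lborel) \<partial>M)"
    by (intro nn_integral_cong)
      (subst nn_integral_distr, simp_all add: distributed_nn_integral[OF B])
  finally show ?thesis .
qed

text \<open>For fixed \<open>Z\<close> the centred \<open>W\<close> contributes just its variance.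
  In \<open>ennreal\<close> the identity also covers a \<open>Z\<close> with infinite second moment,
  which a deviating report can produce.\<close>

lemma (in prob_space) nn_integral_sq_diff_indep_normal:
  assumes ind: "indep_var borel Z borel W"
    and W: "distributed M lborel W (normal_density 0 \<tau>)" and "0 < \<tau>"
  shows "(\<integral>\<^sup>+\<omega>. ennreal ((Z \<omega> - W \<omega>)\<^sup>2) \<partial>M)
    = (\<integral>\<^sup>+\<omega>. ennreal ((Z \<omega>)\<^sup>2) \<partial>M) + ennreal (\<tau>\<^sup>2)"
proof -
  have [measurable]: "random_variable borel Z"
    using ind indep_var_rv1 by blast
  have "(\<integral>\<^sup>+\<omega>. ennreal ((Z \<omega> - W \<omega>)\<^sup>2) \<partial>M)
      = (\<integral>\<^sup>+\<omega>. ennreal ((Z \<omega>)\<^sup>2) + ennreal (\<tau>\<^sup>2) \<partial>M)"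
    by (subst nn_integral_indep_distributed[OF ind W])
      (simp_all add: nn_integral_normal_sq_dist[OF \<open>0 < \<tau>\<close>])
  then show ?thesis
    by (simp add: nn_integral_add emeasure_space_1)
qed

text \<open>Conditioning on the observation \<open>y\<close> leaves \<open>X\<close> normal around
  its posterior mean, so the conditional error is the squared distance of \<open>r y\<close> from
  that mean plus the posterior variance. Only the first summand depends on \<open>r\<close>.\<close>

lemma (in prob_space) nn_integral_estimation_error:
  assumes ind: "indep_var borel X borel V"
    and X: "distributed M lborel X (normal_density 0 \<sigma>)" and \<sigma>: "0 < \<sigma>"
    and V: "distributed M lborel V (normal_density 0 \<tau>)" and \<tau>: "0 < \<tau>"
    and r [measurable]: "r \<in> borel_measurable borel"
  shows "(\<integral>\<^sup>+\<omega>. ennreal ((r (X \<omega> + V \<omega>) - X \<omega>)\<^sup>2) \<partial>M)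
    = (\<integral>\<^sup>+y. ennreal (normal_density 0 (sqrt (\<sigma>\<^sup>2 + \<tau>\<^sup>2)) y) *
          ennreal ((r y - \<sigma>\<^sup>2 / (\<sigma>\<^sup>2 + \<tau>\<^sup>2) * y)\<^sup>2 + \<sigma>\<^sup>2 * \<tau>\<^sup>2 / (\<sigma>\<^sup>2 + \<tau>\<^sup>2)) \<partial>lborel)"
proof -
  let ?f = "\<lambda>x y. ennreal ((r y - x)\<^sup>2)"
  let ?s = "sqrt (\<sigma>\<^sup>2 * \<tau>\<^sup>2 / (\<sigma>\<^sup>2 + \<tau>\<^sup>2))"
  have s: "0 < ?s" and ss: "?s\<^sup>2 = \<sigma>\<^sup>2 * \<tau>\<^sup>2 / (\<sigma>\<^sup>2 + \<tau>\<^sup>2)"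
    using \<sigma> \<tau> by (simp_all add: add_pos_pos)
  have "(\<integral>\<^sup>+\<omega>. ?f (X \<omega>) (X \<omega> + V \<omega>) \<partial>M)
      = (\<integral>\<^sup>+\<omega>. (\<integral>\<^sup>+w. ennreal (normal_density 0 \<tau> w) * ?f (X \<omega>) (X \<omega> + w) \<partial>lborel) \<partial>M)"
    by (rule nn_integral_indep_distributed[OF ind V, of "\<lambda>x w. ?f x (x + w)"]) simp
  also have "\<dots> = (\<integral>\<^sup>+x. ennreal (normal_density 0 \<sigma> x) *
      (\<integral>\<^sup>+w. ennreal (normal_density 0 \<tau> w) * ?f x (x + w) \<partial>lborel) \<partial>lborel)"
    by (rule distributed_nn_integral[OF X, symmetric]) simp
  \<comment> \<open>Substitute \<open>y = x + w\<close>, so that the inner variable becomes the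
    observation and the order of integration can be swapped.\<close>
  also have "\<dots> = (\<integral>\<^sup>+x. ennreal (normal_density 0 \<sigma> x) *
      (\<integral>\<^sup>+y. ennreal (normal_density 0 \<tau> (y - x)) * ?f x y \<partial>lborel) \<partial>lborel)"
    using nn_integral_real_affine[of "\<lambda>y. ennreal (normal_density 0 \<tau> (y - x)) * ?f x y" 1 x for x]
    by simp
  also have "\<dots> = (\<integral>\<^sup>+x. \<integral>\<^sup>+y. ennreal (normal_density 0 \<sigma> x * normal_density 0 \<tau> (y - x)) * ?f x y
      \<partial>lborel \<partial>lborel)"
    by (simp add: nn_integral_cmult[symmetric] ennreal_mult mult.assoc)
  also have "\<dots> = (\<integral>\<^sup>+y. \<integral>\<^sup>+x. ennreal (normal_density 0 \<sigma> x * normal_density 0 \<tau> (y - x)) * ?f x y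
      \<partial>lborel \<partial>lborel)"
    by (rule lborel_pair.Fubini'[symmetric]) simp
  also have "\<dots> = (\<integral>\<^sup>+y. ennreal (normal_density 0 (sqrt (\<sigma>\<^sup>2 + \<tau>\<^sup>2)) y) *
      (\<integral>\<^sup>+x. ennreal (normal_density (\<sigma>\<^sup>2 / (\<sigma>\<^sup>2 + \<tau>\<^sup>2) * y) ?s x) * ?f x y \<partial>lborel) \<partial>lborel)"
    unfolding normal_density_bayes[OF \<sigma> \<tau>]
    by (simp add: nn_integral_cmult[symmetric] ennreal_mult mult.assoc)
  also have "\<dots> = (\<integral>\<^sup>+y. ennreal (normal_density 0 (sqrt (\<sigma>\<^sup>2 + \<tau>\<^sup>2)) y) *
          ennreal ((r y - \<sigma>\<^sup>2 / (\<sigma>\<^sup>2 + \<tau>\<^sup>2) * y)\<^sup>2 + \<sigma>\<^sup>2 * \<tau>\<^sup>2 / (\<sigma>\<^sup>2 + \<tau>\<^sup>2)) \<partial>lborel)"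
    unfolding nn_integral_normal_sq_dist[OF s] ss ..
  finally show ?thesis .
qed

lemma nn_integral_normal_density_const:
  assumes "0 < \<sigma>"
  shows "(\<integral>\<^sup>+y. ennreal (normal_density \<mu> \<sigma> y) * K \<partial>lborel) = K"
  using assms by (simp add: nn_integral_multc nn_integral_eq_integral)

text \<open>Dropping the squared distance from the posterior mean leaves a constant, integrated
  against a probability density.\<close>

lemma (in prob_space) mmse_lower_bound:
  assumes "indep_var borel X borel V"
    and "distributed M lborel X (normal_density 0 \<sigma>)" and "0 < \<sigma>"
    and "distributed M lborel V (normal_density 0 \<tau>)" and "0 < \<tau>"
    and "r \<in> borel_measurable borel"
  shows "ennreal (\<sigma>\<^sup>2 * \<tau>\<^sup>2 / (\<sigma>\<^sup>2 + \<tau>\<^sup>2)) \<le> (\<integral>\<^sup>+\<omega>. ennreal ((r (X \<omega> + V \<omega>) - X \<omega>)\<^sup>2) \<partial>M)"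
proof -
  have "0 < sqrt (\<sigma>\<^sup>2 + \<tau>\<^sup>2)"
    using assms by (simp add: add_pos_pos)
  then have "ennreal (\<sigma>\<^sup>2 * \<tau>\<^sup>2 / (\<sigma>\<^sup>2 + \<tau>\<^sup>2)) = (\<integral>\<^sup>+y. ennreal (normal_density 0 (sqrt (\<sigma>\<^sup>2 + \<tau>\<^sup>2)) y) *
          ennreal (\<sigma>\<^sup>2 * \<tau>\<^sup>2 / (\<sigma>\<^sup>2 + \<tau>\<^sup>2)) \<partial>lborel)"
    by (rule nn_integral_normal_density_const[symmetric])
  also have "\<dots> \<le> (\<integral>\<^sup>+\<omega>. ennreal ((r (X \<omega> + V \<omega>) - X \<omega>)\<^sup>2) \<partial>M)"
    unfolding nn_integral_estimation_error[OF assms]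
    by (intro nn_integral_mono mult_left_mono ennreal_leI) simp_all
  finally show ?thesis .
qed

text \<open>At the posterior mean the dropped square is zero.\<close>

lemma (in prob_space) mmse_attained:
  assumes "indep_var borel X borel V"
    and "distributed M lborel X (normal_density 0 \<sigma>)" and "0 < \<sigma>"
    and "distributed M lborel V (normal_density 0 \<tau>)" and "0 < \<tau>"
  shows "(\<integral>\<^sup>+\<omega>. ennreal ((\<sigma>\<^sup>2 / (\<sigma>\<^sup>2 + \<tau>\<^sup>2) * (X \<omega> + V \<omega>) - X \<omega>)\<^sup>2) \<partial>M)
    = ennreal (\<sigma>\<^sup>2 * \<tau>\<^sup>2 / (\<sigma>\<^sup>2 + \<tau>\<^sup>2))"
proof -
  have "0 < sqrt (\<sigma>\<^sup>2 + \<tau>\<^sup>2)"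
    using assms by (simp add: add_pos_pos)
  then show ?thesis
    using nn_integral_estimation_error[OF assms, of "\<lambda>y. \<sigma>\<^sup>2 / (\<sigma>\<^sup>2 + \<tau>\<^sup>2) * y"]
    by (simp add: nn_integral_normal_density_const)
qed

section \<open>Extended expectations of quadratic-type penalties\<close>

lemma (in prob_space) ext_expectation_integrable:
  assumes "integrable M f"
  shows "ext_expectation M f = ereal (expectation f)"
proof -
  have "(\<integral>\<^sup>+\<omega>. ennreal (f \<omega>) \<partial>M) \<noteq> \<infinity>" "(\<integral>\<^sup>+\<omega>. ennreal (- f \<omega>) \<partial>M) \<noteq> \<infinity>"
    using assms by (simp_all add: real_integrable_def)
  then show ?thesis
    unfolding ext_expectation_def real_lebesgue_integral_def[OF assms]
    by (cases "\<integral>\<^sup>+\<omega>. ennreal (f \<omega>) \<partial>M"; cases "\<integral>\<^sup>+\<omega>. ennreal (- f \<omega>) \<partial>M") (auto)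
qed

lemma (in prob_space) ext_expectation_const [simp]: "ext_expectation M (\<lambda>_. k) = ereal k"
  by (simp add: ext_expectation_integrable prob_space)

lemma (in prob_space) ext_expectation_penalty_eq:
  assumes [measurable]: "W \<in> borel_measurable M" and nn: "\<And>\<omega>. 0 \<le> W \<omega>"
    and m: "(\<integral>\<^sup>+\<omega>. ennreal (W \<omega>) \<partial>M) = ennreal m" "0 \<le> m"
  shows "ext_expectation M (\<lambda>\<omega>. K - \<beta> * W \<omega>) = ereal (K - \<beta> * m)"
proof -
  have "integrable M W"
    by (rule integrableI_nonneg) (use nn m in simp_all)
  moreover have "expectation W = m"
    by (subst integral_eq_nn_integral) (use nn m in simp_all)
  ultimately show ?thesis
    by (simp add: ext_expectation_integrable prob_space)
qed

text \<open>If \<open>W\<close> has finite mean, this is linearity and monotonicity. If its mean is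
  infinite, the positive part of \<open>K - \<beta> * W\<close> is still bounded, so the expectation
  is \<open>-\<infinity>\<close> and never the ambiguous
  \<open>\<infinity> - \<infinity>\<close>.\<close>

lemma (in prob_space) ext_expectation_penalty_le:
  assumes [measurable]: "W \<in> borel_measurable M" and nn: "\<And>\<omega>. 0 \<le> W \<omega>" and \<beta>: "0 < \<beta>"
    and m: "ennreal m \<le> (\<integral>\<^sup>+\<omega>. ennreal (W \<omega>) \<partial>M)"
  shows "ext_expectation M (\<lambda>\<omega>. K - \<beta> * W \<omega>) \<le> ereal (K - \<beta> * m)"
proof (cases "\<integral>\<^sup>+\<omega>. ennreal (W \<omega>) \<partial>M")
  case (real q)
  then have "m \<le> q"
    using m by (simp add: ennreal_le_iff)
  then show ?thesis
    using \<beta> ext_expectation_penalty_eq[OF assms(1) nn real(2) real(1)] by simp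
next
  case top
  have "(\<integral>\<^sup>+\<omega>. ennreal (K - \<beta> * W \<omega>) \<partial>M) \<le> (\<integral>\<^sup>+\<omega>. ennreal K \<partial>M)"
    using nn \<beta> by (intro nn_integral_mono ennreal_leI) simp
  then have pos: "(\<integral>\<^sup>+\<omega>. ennreal (K - \<beta> * W \<omega>) \<partial>M) < \<top>"
    by (simp add: emeasure_space_1 order.strict_trans1)
  have "(\<top>::ennreal) = ennreal \<beta> * (\<integral>\<^sup>+\<omega>. ennreal (W \<omega>) \<partial>M)"
    using top \<beta> by (simp add: ennreal_mult_top)
  also have "\<dots> = (\<integral>\<^sup>+\<omega>. ennreal (\<beta> * W \<omega>) \<partial>M)"
    using nn \<beta> by (subst nn_integral_cmult[symmetric]) (simp_all add: ennreal_mult)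
  \<comment> \<open>\<open>\<beta> * W\<close> exceeds the negative part of
    \<open>K - \<beta> * W\<close> by at most \<open>\<bar>K\<bar>\<close>, so the infinite integral
    passes to the negative part.\<close>
  also have "\<dots> \<le> (\<integral>\<^sup>+\<omega>. ennreal (- (K - \<beta> * W \<omega>)) + ennreal \<bar>K\<bar> \<partial>M)"
    by (intro nn_integral_mono) (subst ennreal_plus_if, auto intro!: ennreal_leI)
  also have "\<dots> = (\<integral>\<^sup>+\<omega>. ennreal (- (K - \<beta> * W \<omega>)) \<partial>M) + ennreal \<bar>K\<bar>"
    by (simp add: nn_integral_add emeasure_space_1)
  finally have "(\<integral>\<^sup>+\<omega>. ennreal (- (K - \<beta> * W \<omega>)) \<partial>M) = \<top>"
    by (simp add: top_unique)
  with pos show ?thesis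
    unfolding ext_expectation_def
    by (cases "\<integral>\<^sup>+\<omega>. ennreal (K - \<beta> * W \<omega>) \<partial>M") auto
qed

section \<open>Effort cost against the value of precision\<close>

text \<open>Each side is the expected loss from limited precision plus the effort cost, with
  \<open>a\<close> the prior precision. The bound on \<open>\<beta>\<close> makes the marginal gain
  in precision at least the marginal cost.\<close>

lemma effort_cost_payoff_max:
  assumes cost: "effort_cost ub c c' c''" and "0 < a"
    and \<beta>: "(SUP x\<in>{0..ub}. c' x * (a + x)\<^sup>2) < \<beta>" and e: "e \<in> {0..ub}"
  shows "\<beta> / (a + ub) + c ub \<le> \<beta> / (a + e) + c e"
proof -
  have dc: "(c has_real_derivative c' x) (at x within {0..ub})"
    and dc': "(c' has_real_derivative c'' x) (at x within {0..ub})" if "x \<in> {0..ub}" for x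
    using cost that by (auto simp: effort_cost_def)
  have cont: "continuous_on {0..ub} c" "continuous_on {0..ub} c'"
    using dc dc' by (blast intro: DERIV_continuous_on)+
  \<comment> \<open>A real \<open>SUP\<close> bounds its set only if the set is bounded above. Here
    \<open>c'\<close> is differentiable, hence continuous, on a compact interval.\<close>
  have "bdd_above ((\<lambda>x. c' x * (a + x)\<^sup>2) ` {0..ub})"
    by (intro bounded_imp_bdd_above compact_imp_bounded compact_continuous_image
        continuous_intros cont) simp
  then have \<beta>x: "c' x * (a + x)\<^sup>2 \<le> \<beta>" if "x \<in> {0..ub}" for x
    using \<beta> that cSUP_upper[of x "{0..ub}" "\<lambda>x. c' x * (a + x)\<^sup>2"] by simp
  have "- \<beta> / (a + e) - c e \<le> - \<beta> / (a + ub) - c ub"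
  \<comment> \<open>The version for open intervals is used because the derivative of
    \<open>c\<close> at \<open>0\<close> and \<open>ub\<close> is only one-sided.\<close>
  proof (rule DERIV_nonneg_imp_increasing_open[where f="\<lambda>x. - \<beta> / (a + x) - c x"])
    show "e \<le> ub" using e by simp
    fix x assume x: "e < x" "x < ub"
    then have xi: "x \<in> {0..ub}" and x0: "0 < a + x" using e \<open>0 < a\<close> by auto
    have "(c has_real_derivative c' x) (at x)"
      using dc[OF xi] x e by (simp add: at_within_Icc_at)
    then have "((\<lambda>x. - \<beta> / (a + x) - c x) has_real_derivative \<beta> / (a + x)\<^sup>2 - c' x) (at x)"
      using x0 by (auto intro!: derivative_eq_intros simp: power2_eq_square)
    moreover have "0 \<le> \<beta> / (a + x)\<^sup>2 - c' x"
      using \<beta>x[OF xi] x0 by (simp add: field_simps)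
    ultimately show "\<exists>y. ((\<lambda>x. - \<beta> / (a + x) - c x) has_real_derivative y) (at x) \<and> 0 \<le> y"
      by blast
  next
    show "continuous_on {e..ub} (\<lambda>x. - \<beta> / (a + x) - c x)"
      using e \<open>0 < a\<close> by (intro continuous_intros continuous_on_subset[OF cont(1)]) auto
  qed
  then show ?thesis by simp
qed

text \<open>The value at zero effort, \<open>c' 0 * a\<^sup>2\<close>, is already positive. The sign
  of \<open>\<beta>\<close> is what turns lower bounds on the error into upper bounds on the
  payment.\<close>

lemma payment_slope_pos:
  assumes cost: "effort_cost ub c c' c''" and "0 < a" "0 \<le> ub"
    and \<beta>: "(SUP x\<in>{0..ub}. c' x * (a + x)\<^sup>2) < \<beta>"
  shows "0 < \<beta>"
proof -
  have "continuous_on {0..ub} c'"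
    using cost unfolding effort_cost_def by (blast intro: DERIV_continuous_on)
  then have "bdd_above ((\<lambda>x. c' x * (a + x)\<^sup>2) ` {0..ub})"
    by (intro bounded_imp_bdd_above compact_imp_bounded compact_continuous_image
        continuous_intros) simp_all
  then have "c' 0 * a\<^sup>2 \<le> (SUP x\<in>{0..ub}. c' x * (a + x)\<^sup>2)"
    using \<open>0 \<le> ub\<close> cSUP_upper[of 0 "{0..ub}" "\<lambda>x. c' x * (a + x)\<^sup>2"] by simp
  moreover have "0 < c' 0 * a\<^sup>2"
    using cost \<open>0 < a\<close> \<open>0 \<le> ub\<close> by (simp add: effort_cost_def)
  ultimately show ?thesis using \<beta> by linarith
qed

section \<open>Independence and errors in the sensor model\<close>

text \<open>Instantiate the model at the effort profile in which \<open>i\<close> exerts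
  \<open>e\<close>, \<open>k\<close> its maximum and all others nothing. Sensors without effort
  leave the family, and so does \<open>i\<close> when \<open>e = 0\<close>.\<close>

lemma sensor_model_indep:
  assumes "sensor_model M N \<sigma> u X v" and "i \<in> {1..N}" "k \<in> {1..N}" "i \<noteq> k" "e \<in> {0..u i}"
  shows "prob_space.indep_vars M (\<lambda>_. borel)
    (\<lambda>n. case n of None \<Rightarrow> X | Some l \<Rightarrow> v l (if l = i then e else u k))
    (insert None (Some ` (if e = 0 then {k} else {i, k})))"
proof -
  interpret prob_space M using assms by (simp add: sensor_model_def)
  define \<xi> where "\<xi> l = (if l = i then e else if l = k then u k else 0)" for l
  have "\<forall>l\<in>{1..N}. \<xi> l \<in> {0..u l}" and "0 < u k"
    using assms by (auto simp: \<xi>_def sensor_model_def less_imp_le)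
  then have "indep_vars (\<lambda>_. borel) (\<lambda>n. case n of None \<Rightarrow> X | Some l \<Rightarrow> v l (\<xi> l))
      (insert None (Some ` {l\<in>{1..N}. 0 < \<xi> l}))"
    using assms(1) unfolding sensor_model_def by blast
  also have "{l\<in>{1..N}. 0 < \<xi> l} = (if e = 0 then {k} else {i, k})"
    using assms \<open>0 < u k\<close> by (auto simp: \<xi>_def split: if_splits)
  finally show ?thesis
    \<comment> \<open>The two families of variables need to agree only on the index set.\<close>
    by (rule iffD1[OF indep_vars_cong, rotated -1])
      (use assms in \<open>auto simp: \<xi>_def split: if_splits\<close>)
qed

lemma sensor_model_indep_own:
  assumes model: "sensor_model M N \<sigma> u X v"
    and "i \<in> {1..N}" "k \<in> {1..N}" "i \<noteq> k" "e \<in> {0<..u i}"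
  shows "prob_space.indep_var M borel X borel (v i e)"
proof -
  interpret prob_space M using model by (simp add: sensor_model_def)
  have "indep_vars (\<lambda>_. borel)
      (\<lambda>n. case n of None \<Rightarrow> X | Some l \<Rightarrow> v l (if l = i then e else u k)) {None, Some i, Some k}"
    using sensor_model_indep[OF model, of i k e] assms by simp
  from indep_var_compose[OF indep_var_restrict[OF this, of "{None}" "{Some i}"],
      of "\<lambda>f. f None" borel "\<lambda>f. f (Some i)" borel]
  show ?thesis
    by (simp add: comp_def measurable_component_singleton)
qed

text \<open>The error of the report is a measurable function of the state and the sensor's own
  noise, a block of the independent family disjoint from the peer's noise.\<close>

lemma sensor_model_indep_peer:
  assumes model: "sensor_model M N \<sigma> u X v"
    and ik: "i \<in> {1..N}" "k \<in> {1..N}" "i \<noteq> k" and e: "e \<in> {0..u i}"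
    and r [measurable]: "r \<in> borel_measurable borel"
  shows "prob_space.indep_var M borel (\<lambda>\<omega>. r (observation X v y0 i e \<omega>) - X \<omega>) borel (v k (u k))"
proof -
  interpret prob_space M using model by (simp add: sensor_model_def)
  define Z where "Z n = (case n of None \<Rightarrow> X | Some l \<Rightarrow> v l (if l = i then e else u k))" for n
  define A where "A = (if e = 0 then {None} else {None, Some i})"
  have ind: "indep_vars (\<lambda>_. borel) Z (A \<union> {Some k})"
    using sensor_model_indep[OF model ik e]
    by (simp add: Z_def[abs_def] A_def insert_commute split: if_splits)
  \<comment> \<open>\<open>h\<close> computes the error from the coordinates in \<open>A\<close>.
    For \<open>e = 0\<close> it ignores \<open>Some i\<close>, which is then not in
    \<open>A\<close>.\<close>
  define h where "h f = r (if e = 0 then y0 i else f None + f (Some i)) - f None"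
    for f :: "nat option \<Rightarrow> real"
  have h: "h \<in> borel_measurable (PiM A (\<lambda>_. borel))"
  proof -
    have [measurable]: "(\<lambda>f. f n) \<in> borel_measurable (PiM A (\<lambda>_. borel :: real measure))"
      if "n \<in> A" for n
      using that by (rule measurable_component_singleton)
    have "None \<in> A" "e \<noteq> 0 \<Longrightarrow> Some i \<in> A"
      by (simp_all add: A_def)
    then show ?thesis
      unfolding h_def[abs_def] by (cases "e = 0") simp_all
  qed
  have "indep_var borel (h \<circ> (\<lambda>\<omega>. restrict (\<lambda>n. Z n \<omega>) A))
      borel ((\<lambda>f. f (Some k)) \<circ> (\<lambda>\<omega>. restrict (\<lambda>n. Z n \<omega>) {Some k}))"
    by (intro indep_var_compose[OF indep_var_restrict[OF ind] h] measurable_component_singleton)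
      (use ik in \<open>auto simp: A_def\<close>)
  also have "h \<circ> (\<lambda>\<omega>. restrict (\<lambda>n. Z n \<omega>) A) = (\<lambda>\<omega>. r (observation X v y0 i e \<omega>) - X \<omega>)"
    by (auto simp: h_def A_def Z_def observation_def)
  also have "(\<lambda>f. f (Some k)) \<circ> (\<lambda>\<omega>. restrict (\<lambda>n. Z n \<omega>) {Some k}) = v k (u k)"
    using ik by (auto simp: Z_def)
  finally show ?thesis .
qed

text \<open>Regroup the discrepancy as the error about \<open>X\<close> minus the peer's noise,
  which is centred, independent of that error and of variance \<open>1 / u k\<close>.\<close>

lemma peer_error_split:
  assumes model: "sensor_model M N \<sigma> u X v"
    and ik: "i \<in> {1..N}" "k \<in> {1..N}" "i \<noteq> k" and e: "e \<in> {0..u i}"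
    and r: "r \<in> borel_measurable borel"
  shows "(\<integral>\<^sup>+\<omega>. ennreal ((r (observation X v y0 i e \<omega>) - (X \<omega> + v k (u k) \<omega>))\<^sup>2) \<partial>M)
    = (\<integral>\<^sup>+\<omega>. ennreal ((r (observation X v y0 i e \<omega>) - X \<omega>)\<^sup>2) \<partial>M) + ennreal (1 / u k)"
proof -
  interpret prob_space M using model by (simp add: sensor_model_def)
  have "0 < u k" using model ik by (simp add: sensor_model_def)
  then have "distributed M lborel (v k (u k)) (normal_density 0 (sqrt (1 / u k)))"
    and "0 < sqrt (1 / u k)"
    using model ik by (simp_all add: sensor_model_def)
  from nn_integral_sq_diff_indep_normal[OF sensor_model_indep_peer[OF model ik e r, of y0] this]
  show ?thesis
    using \<open>0 < u k\<close> by (simp add: diff_diff_eq)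
qed

text \<open>The posterior variance in terms of precisions: prior precision and effort add
  up.\<close>

lemma harmonic_precision:
  fixes \<sigma> e :: real
  assumes "0 < \<sigma>" "0 < e"
  shows "\<sigma>\<^sup>2 * (sqrt (1 / e))\<^sup>2 / (\<sigma>\<^sup>2 + (sqrt (1 / e))\<^sup>2) = 1 / (1 / \<sigma>\<^sup>2 + e)"
proof -
  define s where "s = \<sigma>\<^sup>2"
  have "0 < s" using assms by (simp add: s_def)
  moreover have "(sqrt (1 / e))\<^sup>2 = 1 / e" using assms by simp
  ultimately show ?thesis
    unfolding s_def[symmetric] using assms by (simp add: field_simps add_pos_pos)
qed

lemma sensor_estimation_error_ge:
  assumes model: "sensor_model M N \<sigma> u X v"
    and ik: "i \<in> {1..N}" "k \<in> {1..N}" "i \<noteq> k" and e: "e \<in> {0..u i}"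
    and r [measurable]: "r \<in> borel_measurable borel"
  shows "ennreal (1 / (1 / \<sigma>\<^sup>2 + e))
    \<le> (\<integral>\<^sup>+\<omega>. ennreal ((r (observation X v y0 i e \<omega>) - X \<omega>)\<^sup>2) \<partial>M)"
proof -
  interpret prob_space M using model by (simp add: sensor_model_def)
  have \<sigma>: "0 < \<sigma>" and X: "distributed M lborel X (normal_density 0 \<sigma>)"
    using model by (simp_all add: sensor_model_def)
  show ?thesis
  proof (cases "e = 0")
    case True
    \<comment> \<open>Without effort the report is a constant, whose error is at least the prior
      variance; this is the claimed bound at \<open>e = 0\<close>.\<close>
    have "(\<integral>\<^sup>+\<omega>. ennreal ((r (y0 i) - X \<omega>)\<^sup>2) \<partial>M) = ennreal ((r (y0 i) - 0)\<^sup>2 + \<sigma>\<^sup>2)"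
      using distributed_nn_integral[OF X, of "\<lambda>x. ennreal ((r (y0 i) - x)\<^sup>2)"]
        nn_integral_normal_sq_dist[OF \<sigma>, of 0 "r (y0 i)"] by simp
    then show ?thesis
      using True by (simp add: observation_def)
  next
    case False
    then have e': "e \<in> {0<..u i}" using e by simp
    have "distributed M lborel (v i e) (normal_density 0 (sqrt (1 / e)))"
      using model ik e' by (simp add: sensor_model_def)
    from mmse_lower_bound[OF sensor_model_indep_own[OF model ik e'] X \<sigma> this _ r]
    show ?thesis
      unfolding harmonic_precision[OF \<sigma>, of e] observation_def
      using e' False harmonic_precision[OF \<sigma>, of e] by simp
  qed
qed

lemma local_estimate_error:
  assumes model: "sensor_model M N \<sigma> u X v"
    and ik: "i \<in> {1..N}" "k \<in> {1..N}" "i \<noteq> k" and e: "e \<in> {0<..u i}"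
  shows "(\<integral>\<^sup>+\<omega>. ennreal ((local_estimate \<sigma> e (observation X v y0 i e \<omega>) - X \<omega>)\<^sup>2) \<partial>M)
    = ennreal (1 / (1 / \<sigma>\<^sup>2 + e))"
proof -
  interpret prob_space M using model by (simp add: sensor_model_def)
  have \<sigma>: "0 < \<sigma>" and X: "distributed M lborel X (normal_density 0 \<sigma>)"
    and V: "distributed M lborel (v i e) (normal_density 0 (sqrt (1 / e)))"
    and e0: "0 < e" "0 < sqrt (1 / e)"
    using model ik e by (simp_all add: sensor_model_def)
  have "(sqrt (1 / e))\<^sup>2 = 1 / e" using e0 by simp
  with mmse_attained[OF sensor_model_indep_own[OF model ik e] X \<sigma> V e0(2)]
  show ?thesis
    using e0 harmonic_precision[OF \<sigma> e0(1)] by (simp add: local_estimate_def observation_def)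
qed


section \<open>The equilibrium and the expected payments\<close>

theorem theorem2:
  fixes M :: "'a measure" and N :: nat
    and X :: "'a \<Rightarrow> real" and v :: "nat \<Rightarrow> real \<Rightarrow> 'a \<Rightarrow> real"
    and \<sigma>x \<xi>x \<Sigma>t :: real and u y0 \<phi> \<beta> \<gamma> :: "nat \<Rightarrow> real"
    and c c' c'' :: "nat \<Rightarrow> real \<Rightarrow> real" and j :: "nat \<Rightarrow> nat"
  assumes model: "sensor_model M N \<sigma>x u X v"
    and xi_x: "\<xi>x = 1 / \<sigma>x\<^sup>2"
    and threshold: "0 < \<Sigma>t"
    and cost: "\<forall>i\<in>{1..N}. effort_cost (u i) (c i) (c' i) (c'' i)"
    and condition_fails:
      "\<not> (\<forall>i\<in>{1..N}. \<forall>x\<in>{0..u i}. - 2 * c' i x - c'' i x * (\<xi>x + x) < 0)"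
    and optimal: "optimal_selection N \<xi>x u \<Sigma>t c \<phi>"
    and two_selected: "2 \<le> card {i\<in>{1..N}. \<phi> i = 1}"
    and peer: "\<forall>i\<in>{1..N}. \<phi> i = 1 \<longrightarrow> j i \<in> {1..N} \<and> j i \<noteq> i \<and> \<phi> (j i) = 1"
    and beta: "\<forall>i\<in>{1..N}. \<phi> i = 1 \<longrightarrow> (SUP x\<in>{0..u i}. c' i x * (\<xi>x + x)\<^sup>2) < \<beta> i"
    and gamma: "\<forall>i\<in>{1..N}. \<phi> i = 1 \<longrightarrow>
      \<gamma> i = \<beta> i * (1 / (\<xi>x + u i) + 1 / u (j i)) + c i (u i)"
  shows "nash_equilibrium {1..N} (\<lambda>i. strategies (u i))
           (expected_utility M X v y0 c (peer_payment \<phi> \<beta> \<gamma> j))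
           (truthful_profile \<sigma>x u \<phi>)
       \<and> (\<forall>i\<in>{1..N}. \<phi> i = 1 \<longrightarrow>
           expected_payment M X v y0 (peer_payment \<phi> \<beta> \<gamma> j) i (truthful_profile \<sigma>x u \<phi>)
             = ereal (c i (u i)))"
proof -
  interpret prob_space M using model by (simp add: sensor_model_def)
  let ?s = "truthful_profile \<sigma>x u \<phi>" and ?p = "peer_payment \<phi> \<beta> \<gamma> j"
  have \<sigma>: "0 < \<sigma>x" and \<xi>x: "0 < \<xi>x"
    using model by (simp_all add: sensor_model_def xi_x)
  have u: "0 < u i" if "i \<in> {1..N}" for i
    using model that by (simp add: sensor_model_def)
  have [measurable]: "random_variable borel X"
    using model by (auto simp: sensor_model_def dest: distributed_measurable)
  have v_meas: "random_variable borel (v i e)" if "i \<in> {1..N}" "e \<in> {0<..u i}" for i e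
  proof -
    have "distributed M lborel (v i e) (normal_density 0 (sqrt (1 / e)))"
      using model that by (simp add: sensor_model_def)
    then show ?thesis
      using distributed_measurable by fastforce
  qed
  have obs_meas: "random_variable borel (observation X v y0 i e)"
    if "i \<in> {1..N}" "e \<in> {0..u i}" for i e
  proof (cases "e = 0")
    case False
    then have [measurable]: "random_variable borel (v i e)"
      using that by (intro v_meas) auto
    show ?thesis using False by (simp add: observation_def[abs_def])
  qed (simp add: observation_def[abs_def])
  have truth: "?s i \<in> strategies (u i)" if "i \<in> {1..N}" for i
    using u[OF that] by (auto simp: truthful_profile_def strategies_def Let_def local_estimate_def[abs_def])

  define err where "err i t \<omega> = (est_report t (observation X v y0 i (effort t) \<omega>)
      - (X \<omega> + v (j i) (u (j i)) \<omega>))\<^sup>2" for i \<omega> and t :: strategy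
  \<comment> \<open>As \<open>j i\<close> differs from \<open>i\<close>, the deviation leaves the
    peer truthful; as the peer is selected, it observes with its positive maximum effort.\<close>
  have pay: "realized_payment X v y0 ?p i (?s(i := t)) = (\<lambda>\<omega>. \<gamma> i - \<beta> i * err i t \<omega>)"
    if "i \<in> {1..N}" "\<phi> i = 1" for i t
    using that peer u[of "j i"]
    by (intro ext) (auto simp: realized_payment_def peer_payment_def err_def truthful_profile_def
        Let_def observation_def)
  have err_meas: "err i t \<in> borel_measurable M" and err_nonneg: "0 \<le> err i t \<omega>"
    if "i \<in> {1..N}" "\<phi> i = 1" "t \<in> strategies (u i)" for i t \<omega>
  proof -
    have [measurable]: "est_report t \<in> borel_measurable borel"
      "random_variable borel (observation X v y0 i (effort t))"
      "random_variable borel (v (j i) (u (j i)))"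
      using that peer u[of "j i"] obs_meas v_meas by (auto simp: strategies_def)
    show "err i t \<in> borel_measurable M" unfolding err_def[abs_def] by measurable
  qed (simp add: err_def)
  \<comment> \<open>The least expected squared discrepancy attainable with effort
    \<open>e\<close>.\<close>
  define m where "m i e = 1 / (\<xi>x + e) + 1 / u (j i)" for i e
  have m_nonneg: "0 \<le> m i e" if "i \<in> {1..N}" "\<phi> i = 1" "0 \<le> e" for i e
    using that peer u[of "j i"] \<xi>x by (auto simp: m_def intro!: add_nonneg_nonneg)
  have m_split: "ennreal (m i e) = ennreal (1 / (1 / \<sigma>x\<^sup>2 + e)) + ennreal (1 / u (j i))"
    if "i \<in> {1..N}" "\<phi> i = 1" "0 \<le> e" for i e
    using that peer u[of "j i"] \<xi>x unfolding m_def xi_x by (intro ennreal_plus) auto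
  have err_ge: "ennreal (m i (effort t)) \<le> (\<integral>\<^sup>+\<omega>. ennreal (err i t \<omega>) \<partial>M)"
    if i: "i \<in> {1..N}" "\<phi> i = 1" and t: "t \<in> strategies (u i)" for i t
  proof -
    have r: "est_report t \<in> borel_measurable borel" and e: "effort t \<in> {0..u i}"
      using t by (auto simp: strategies_def)
    have k: "j i \<in> {1..N}" "i \<noteq> j i" using i peer by auto
    show ?thesis
      unfolding err_def peer_error_split[OF model i(1) k e r]
      using sensor_estimation_error_ge[OF model i(1) k e r, of y0] m_split[OF i, of "effort t"] e
      by (auto intro: add_right_mono)
  qed
  have err_truth: "(\<integral>\<^sup>+\<omega>. ennreal (err i (?s i) \<omega>) \<partial>M) = ennreal (m i (u i))"
    if i: "i \<in> {1..N}" "\<phi> i = 1" for i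
  proof -
    have r: "local_estimate \<sigma>x (u i) \<in> borel_measurable borel"
      by (simp add: local_estimate_def[abs_def])
    have e: "u i \<in> {0..u i}" "u i \<in> {0<..u i}"
      using u[OF i(1)] by auto
    have k: "j i \<in> {1..N}" "i \<noteq> j i" using i peer by auto
    have s: "est_report (?s i) = local_estimate \<sigma>x (u i)" "effort (?s i) = u i"
      using i by (simp_all add: truthful_profile_def Let_def)
    show ?thesis
      unfolding err_def s peer_error_split[OF model i(1) k e(1) r]
        local_estimate_error[OF model i(1) k e(2)]
      using m_split[OF i, of "u i"] e by simp
  qed
  have slope: "0 < \<beta> i" if "i \<in> {1..N}" "\<phi> i = 1" for i
    using payment_slope_pos[OF _ \<xi>x, of "u i" "c i" "c' i" "c'' i" "\<beta> i"] that cost beta u[of i]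
    by auto
  have \<gamma>: "\<gamma> i = \<beta> i * m i (u i) + c i (u i)" if "i \<in> {1..N}" "\<phi> i = 1" for i
    using gamma that by (simp add: m_def)

  \<comment> \<open>Taking \<open>k = 0\<close> gives the expected payment, taking the effort cost
    for \<open>k\<close> gives the expected utility.\<close>
  have payment_truth: "ext_expectation M (\<lambda>\<omega>. realized_payment X v y0 ?p i ?s \<omega> - k)
      = ereal (c i (u i) - k)"
    if i: "i \<in> {1..N}" "\<phi> i = 1" for i k
  proof -
    \<comment> \<open>Truth-telling is the trivial deviation, so the formula for deviations
      applies.\<close>
    have "realized_payment X v y0 ?p i ?s = (\<lambda>\<omega>. \<gamma> i - \<beta> i * err i (?s i) \<omega>)"
      using pay[OF i, of "?s i"] by simp
    then have "(\<lambda>\<omega>. realized_payment X v y0 ?p i ?s \<omega> - k) = (\<lambda>\<omega>. (\<gamma> i - k) - \<beta> i * err i (?s i) \<omega>)"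
      by (simp add: algebra_simps)
    then show ?thesis
      using ext_expectation_penalty_eq[OF err_meas[OF i truth[OF i(1)]] err_nonneg[OF i truth[OF i(1)]]
          err_truth[OF i] m_nonneg[OF i], of "\<gamma> i - k" "\<beta> i"] u[OF i(1)] \<gamma>[OF i]
      by simp
  qed
  have best: "expected_utility M X v y0 c ?p i (?s(i := t)) \<le> expected_utility M X v y0 c ?p i ?s"
    if iN: "i \<in> {1..N}" and t: "t \<in> strategies (u i)" for i t
  proof (cases "\<phi> i = 1")
    case True
    note i = iN True
    have e: "effort t \<in> {0..u i}" using t by (simp add: strategies_def)
    have "(\<lambda>\<omega>. realized_payment X v y0 ?p i (?s(i := t)) \<omega> - c i (effort ((?s(i := t)) i)))
        = (\<lambda>\<omega>. (\<gamma> i - c i (effort t)) - \<beta> i * err i t \<omega>)"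
      unfolding pay[OF i] by (simp add: algebra_simps)
    then have "expected_utility M X v y0 c ?p i (?s(i := t))
        \<le> ereal (\<gamma> i - c i (effort t) - \<beta> i * m i (effort t))"
      unfolding expected_utility_def
      using ext_expectation_penalty_le[OF err_meas[OF i t] err_nonneg[OF i t] slope[OF i] err_ge[OF i t]]
      by simp
    \<comment> \<open>By the choice of \<open>\<gamma>\<close> the bound is zero at effort
      \<open>u i\<close>, and by the monotonicity in effort it is no larger at
      \<open>effort t\<close>.\<close>
    also have "\<dots> \<le> ereal 0"
      using effort_cost_payoff_max[OF _ \<xi>x _ e, of "c i" "c' i" "c'' i" "\<beta> i"] i cost beta \<gamma>[OF i]
      by (simp add: m_def algebra_simps)
    also have "\<dots> = expected_utility M X v y0 c ?p i ?s"
      unfolding expected_utility_def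
      using payment_truth[OF i, of "c i (effort (?s i))"] i by (simp add: truthful_profile_def Let_def)
    finally show ?thesis .
  next
    case False
    have "expected_utility M X v y0 c ?p i s = ereal (- c i (effort (s i)))" for s
      using False by (simp add: expected_utility_def realized_payment_def peer_payment_def)
    moreover have "0 \<le> c i (effort t)" "c i (effort (?s i)) = 0"
      using cost iN t False by (auto simp: effort_cost_def strategies_def truthful_profile_def Let_def)
    ultimately show ?thesis by simp
  qed
  have "expected_payment M X v y0 ?p i ?s = ereal (c i (u i))" if "i \<in> {1..N}" "\<phi> i = 1" for i
    using payment_truth[OF that, of 0] by (simp add: expected_payment_def)
  with truth best show ?thesis
    by (simp add: nash_equilibrium_def)
qed

end
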